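(* Let $A,B \in \mathbb{C}^{n \times n}$ be such that $$AB^*+BB^*=0 \quad \text{and} \quad B^*A+B^*B=0.$$ Then $$(A+B)^{\dagger}=A^{\dagger}+B^{\dagger}.$$
   Context: $\mathbb{C}^{m\times n}$ is the set of complex $m\times n$ matrices and $X^*$ denotes the conjugate transpose of $X$. For $A\in\mathbb{C}^{m\times n}$, $A^{\dagger}$ denotes the Moore-Penrose inverse of $A$: the unique $X\in\mathbb{C}^{n\times m}$ satisfying $AXA=A$, $XAX=X$, $(AX)^*=AX$ and $(XA)^*=XA$ (it exists for every matrix). *)

theory Defs
  imports "HOL-Analysis.Analysis"
begin

definition conj_transpose :: "complex^'n^'m \<Rightarrow> complex^'m^'n" where
  "conj_transpose A = map_matrix cnj (transpose A)"

definition is_moore_penrose :: "complex^'n^'m \<Rightarrow> complex^'m^'n \<Rightarrow> bool" where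
  "is_moore_penrose A X \<longleftrightarrow>
     A ** X ** A = A \<and> X ** A ** X = X \<and>
     conj_transpose (A ** X) = A ** X \<and> conj_transpose (X ** A) = X ** A"

(* Exactly one such X exists for every A, so the description never defaults. *)
definition moore_penrose :: "complex^'n^'m \<Rightarrow> complex^'m^'n" where
  "moore_penrose A = (THE X. is_moore_penrose A X)"

end

theory Submission
  imports Defs
begin

text \<open>
  Put \<open>C = A + B\<close>. The two hypotheses say exactly \<open>C B\<^sup>* = 0\<close> and \<open>B\<^sup>* C = 0\<close>: the matrices
  \<open>C\<close> and \<open>B\<close> have orthogonal column spaces and orthogonal row spaces. For two such matrices
  the Moore-Penrose inverse is additive, since all mixed products of one matrix with the
  pseudoinverse of the other vanish (\<open>is_moore_penrose_add\<close>). As \<open>A = C + (-B)\<close>, this gives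
  \<open>A\<^sup>\<dagger> = C\<^sup>\<dagger> - B\<^sup>\<dagger>\<close>, which is the claim.

  Because the pseudoinverse is introduced by a definite description, its existence and
  uniqueness have to be established first. Uniqueness is Penrose's computation. For existence,
  projecting orthogonally onto the column space solves the normal equations
  \<open>A\<^sup>* A G = A\<^sup>*\<close>; such a \<open>G\<close> satisfies \<open>A G A = A\<close> and makes \<open>A G\<close> Hermitian. The same
  argument for \<open>A\<^sup>*\<close> yields \<open>K\<close> with \<open>A K A = A\<close> and \<open>K A\<close> Hermitian, and \<open>K A G\<close> meets all
  four Penrose conditions.
\<close>

section \<open>The conjugate transpose\<close>

lemma conj_transpose_nth: "conj_transpose A $ i $ j = cnj (A $ j $ i)"
  by (simp add: conj_transpose_def map_matrix_def transpose_def)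

lemma conj_transpose_conj_transpose [simp]: "conj_transpose (conj_transpose A) = A"
  by (simp add: vec_eq_iff conj_transpose_nth)

lemma conj_transpose_mult:
  "conj_transpose (A ** B) = conj_transpose B ** conj_transpose A"
  by (simp add: vec_eq_iff conj_transpose_nth matrix_matrix_mult_def mult.commute)

lemma conj_transpose_add: "conj_transpose (A + B) = conj_transpose A + conj_transpose B"
  by (simp add: vec_eq_iff conj_transpose_nth)

lemma conj_transpose_minus: "conj_transpose (- A) = - conj_transpose A"
  by (simp add: vec_eq_iff conj_transpose_nth)

lemma conj_transpose_0 [simp]: "conj_transpose 0 = 0"
  by (simp add: vec_eq_iff conj_transpose_nth)

lemma matrix_mult_add_distrib_right: "(A + B) ** C = A ** C + B ** C"
  for A B :: "'a::semiring_1^'n^'m"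
  by (simp add: vec_eq_iff matrix_matrix_mult_def sum.distrib distrib_right)

lemma matrix_mult_minus_left: "(- A) ** B = - (A ** B)" for A :: "'a::ring_1^'n^'m"
  by (simp add: vec_eq_iff matrix_matrix_mult_def sum_negf)

lemma matrix_mult_minus_right: "A ** (- B) = - (A ** B)" for A :: "'a::ring_1^'n^'m"
  by (simp add: vec_eq_iff matrix_matrix_mult_def sum_negf)

lemma matrix_vector_mult_axis: "A *v axis j 1 = column j A"
  for A :: "'a::semiring_1^'n^'m"
  by (simp add: vec_eq_iff matrix_vector_mult_def column_def axis_def if_distrib cong: if_cong)

text \<open>
  The library's inner product on complex vectors is the real part of the Hermitian one. The
  conjugate transpose is the adjoint for it as well, so real orthogonality suffices below.
\<close>

lemma inner_matrix_vector_mult: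
  fixes A :: "complex^'n^'m"
  shows "inner z (A *v w) = inner (conj_transpose A *v z) w"
proof -
  have "inner z (A *v w) = (\<Sum>i\<in>UNIV. \<Sum>j\<in>UNIV. inner (z $ i) (A $ i $ j * w $ j))"
    by (simp add: inner_vec_def matrix_vector_mult_def inner_sum_right)
  also have "\<dots> = (\<Sum>j\<in>UNIV. \<Sum>i\<in>UNIV. inner (z $ i) (A $ i $ j * w $ j))"
    by (rule sum.swap)
  also have "\<dots> = (\<Sum>j\<in>UNIV. \<Sum>i\<in>UNIV. inner (cnj (A $ i $ j) * z $ i) (w $ j))"
    by (intro sum.cong refl) (simp add: inner_complex_def algebra_simps)
  also have "\<dots> = inner (conj_transpose A *v z) w"
    by (simp add: inner_vec_def matrix_vector_mult_def inner_sum_left conj_transpose_nth)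
  finally show ?thesis .
qed

section \<open>Existence and uniqueness of the Moore-Penrose inverse\<close>

text \<open>
  Split \<open>b\<close> into a part \<open>A x\<close> in the column space and a part \<open>z\<close> orthogonal to it; the
  adjoint kills \<open>z\<close>.
\<close>

lemma normal_equation_solvable:
  fixes A :: "complex^'n^'m"
  shows "\<exists>x. conj_transpose A *v (A *v x) = conj_transpose A *v b"
proof -
  have sub: "subspace (range ((*v) A))"
    by (intro linear_subspace_image subspace_UNIV)
      (auto intro!: linearI simp: matrix_vector_right_distrib vec_eq_iff
        matrix_vector_mult_def scaleR_sum_right)
  obtain y z where y: "y \<in> span (range ((*v) A))"
    and z: "\<And>w. w \<in> span (range ((*v) A)) \<Longrightarrow> orthogonal z w" and b: "b = y + z"
    using orthogonal_subspace_decomp_exists[of "range ((*v) A)" b] by blast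
  have "span (range ((*v) A)) = range ((*v) A)"
    using sub by (simp add: span_eq_iff)
  with y obtain x where x: "y = A *v x" by (metis imageE)
  have "inner z (A *v (conj_transpose A *v z)) = 0"
    using z[OF span_base] by (auto simp: orthogonal_def)
  then have "conj_transpose A *v z = 0"
    by (metis inner_matrix_vector_mult inner_eq_zero_iff)
  then have "conj_transpose A *v (A *v x) = conj_transpose A *v b"
    by (simp add: b x matrix_vector_right_distrib)
  then show ?thesis ..
qed

lemma normal_equation_matrix_solvable:
  fixes A :: "complex^'n^'m"
  shows "\<exists>G. conj_transpose A ** A ** G = conj_transpose A"
proof -
  obtain g where g: "\<And>b. conj_transpose A *v (A *v g b) = conj_transpose A *v b"
    using normal_equation_solvable[of A] by metis
  define G :: "complex^'m^'n" where "G = (\<chi> i j. g (axis j 1) $ i)"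
  have G: "G *v axis j 1 = g (axis j 1)" for j
    unfolding matrix_vector_mult_axis by (simp add: column_def G_def vec_eq_iff)
  have "column j (conj_transpose A ** A ** G) = column j (conj_transpose A)" for j
    unfolding matrix_vector_mult_axis[symmetric]
    by (simp add: matrix_vector_mul_assoc[symmetric] G g)
  then have "conj_transpose A ** A ** G = conj_transpose A"
    by (simp add: column_def vec_eq_iff)
  then show ?thesis ..
qed

lemma hermitian_inner_inverse_exists:
  fixes A :: "complex^'n^'m"
  shows "\<exists>G. A ** G ** A = A \<and> conj_transpose (A ** G) = A ** G"
proof -
  obtain G where G: "conj_transpose A ** A ** G = conj_transpose A"
    using normal_equation_matrix_solvable by blast
  then have G': "conj_transpose G ** conj_transpose A ** A = A"
    by (metis conj_transpose_mult conj_transpose_conj_transpose matrix_mul_assoc)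
  \<comment> \<open>Both sides of the next equation equal \<open>G\<^sup>* A\<^sup>* A G\<close>.\<close>
  have herm: "conj_transpose (A ** G) = A ** G"
    by (metis G G' conj_transpose_mult matrix_mul_assoc)
  then have "A ** G ** A = A"
    by (metis G' conj_transpose_mult)
  with herm show ?thesis by blast
qed

lemma moore_penrose_exists:
  fixes A :: "complex^'n^'m"
  shows "\<exists>X. is_moore_penrose A X"
proof -
  obtain G where G: "A ** G ** A = A" "conj_transpose (A ** G) = A ** G"
    using hermitian_inner_inverse_exists by blast
  obtain H where H: "conj_transpose A ** H ** conj_transpose A = conj_transpose A"
      "conj_transpose (conj_transpose A ** H) = conj_transpose A ** H"
    using hermitian_inner_inverse_exists by blast
  define K where "K = conj_transpose H"
  have K: "A ** K ** A = A" "conj_transpose (K ** A) = K ** A"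
    using H unfolding K_def
    by (metis conj_transpose_mult conj_transpose_conj_transpose matrix_mul_assoc)+
  define X where "X = K ** A ** G"
  have AX: "A ** X = A ** G" and XA: "X ** A = K ** A"
    using G(1) K(1) by (metis X_def matrix_mul_assoc)+
  have "X ** A ** X = X"
    using K(1) by (metis X_def XA matrix_mul_assoc)
  then show ?thesis
    using G K AX XA unfolding is_moore_penrose_def by metis
qed

text \<open>
  Both \<open>A X\<close> and \<open>A Y\<close> are the orthogonal projection onto the column space of \<open>A\<close>, hence
  equal; likewise \<open>X A = Y A\<close> on the row space. Then \<open>X = X A X = Y A X = Y A Y = Y\<close>.
\<close>

lemma moore_penrose_unique:
  assumes "is_moore_penrose A X" and "is_moore_penrose A Y"
  shows "X = Y"
proof -
  note X = assms(1)[unfolded is_moore_penrose_def]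
  note Y = assms(2)[unfolded is_moore_penrose_def]
  have "A ** X = conj_transpose (A ** Y ** (A ** X))"
    using X Y by (metis matrix_mul_assoc)
  also have "\<dots> = A ** X ** (A ** Y)"
    using X Y by (metis conj_transpose_mult)
  also have "\<dots> = A ** Y"
    using X by (metis matrix_mul_assoc)
  finally have AX: "A ** X = A ** Y" .
  have "X ** A = conj_transpose (X ** A ** (Y ** A))"
    using X Y by (metis matrix_mul_assoc)
  also have "\<dots> = Y ** A ** (X ** A)"
    using X Y by (metis conj_transpose_mult)
  also have "\<dots> = Y ** A"
    using X by (metis matrix_mul_assoc)
  finally have XA: "X ** A = Y ** A" .
  show ?thesis
    using X Y AX XA by (metis matrix_mul_assoc)
qed

lemma moore_penrose_eqI: "is_moore_penrose A X \<Longrightarrow> moore_penrose A = X"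
  unfolding moore_penrose_def by (rule the_equality) (auto intro: moore_penrose_unique)

lemma is_moore_penrose_moore_penrose: "is_moore_penrose A (moore_penrose A)"
  using moore_penrose_exists moore_penrose_eqI by metis

section \<open>Additivity for orthogonal matrices\<close>

lemma is_moore_penrose_uminus:
  "is_moore_penrose A X \<Longrightarrow> is_moore_penrose (- A) (- X)"
  by (simp add: is_moore_penrose_def matrix_mult_minus_left matrix_mult_minus_right)

text \<open>
  The pseudoinverse \<open>X\<close> of \<open>A\<close> factors as \<open>A\<^sup>* X\<^sup>* X\<close> and as \<open>X X\<^sup>* A\<^sup>*\<close>, so it inherits
  whatever annihilates \<open>A\<^sup>*\<close> from the left or from the right.
\<close>

lemma is_moore_penrose_annihilated_left:
  assumes "is_moore_penrose A X" and "B ** conj_transpose A = 0"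
  shows "B ** X = 0"
proof -
  have "X = conj_transpose A ** (conj_transpose X ** X)"
    using assms(1) unfolding is_moore_penrose_def
    by (metis conj_transpose_mult matrix_mul_assoc)
  then have "B ** X = B ** conj_transpose A ** (conj_transpose X ** X)"
    by (metis matrix_mul_assoc)
  then show ?thesis
    using assms(2) by simp
qed

lemma is_moore_penrose_annihilated_right:
  assumes "is_moore_penrose A X" and "conj_transpose A ** B = 0"
  shows "X ** B = 0"
proof -
  have "X = X ** conj_transpose X ** conj_transpose A"
    using assms(1) unfolding is_moore_penrose_def
    by (metis conj_transpose_mult matrix_mul_assoc)
  then have "X ** B = X ** conj_transpose X ** (conj_transpose A ** B)"
    by (metis matrix_mul_assoc)
  then show ?thesis
    using assms(2) by simp
qed

text \<open>
  With the mixed products gone, \<open>(A + B)(X + Y) = A X + B Y\<close> and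
  \<open>(X + Y)(A + B) = X A + Y B\<close>, and each Penrose condition splits into those of the summands.
\<close>

lemma is_moore_penrose_add:
  assumes X: "is_moore_penrose A X" and Y: "is_moore_penrose B Y"
    and row: "A ** conj_transpose B = 0" and col: "conj_transpose B ** A = 0"
  shows "is_moore_penrose (A + B) (X + Y)"
proof -
  have row': "B ** conj_transpose A = 0" and col': "conj_transpose A ** B = 0"
    using row col by (metis conj_transpose_mult conj_transpose_conj_transpose conj_transpose_0)+
  have mixed: "A ** Y = 0" "Y ** A = 0" "B ** X = 0" "X ** B = 0"
    using is_moore_penrose_annihilated_left[OF Y row]
      is_moore_penrose_annihilated_right[OF Y col]
      is_moore_penrose_annihilated_left[OF X row']
      is_moore_penrose_annihilated_right[OF X col'] .
  have l: "(A + B) ** (X + Y) = A ** X + B ** Y"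
    and r: "(X + Y) ** (A + B) = X ** A + Y ** B"
    by (simp_all add: matrix_add_ldistrib matrix_mult_add_distrib_right mixed)
  have "(A ** X + B ** Y) ** (A + B) = A ** X ** A + B ** Y ** B"
    by (simp add: matrix_add_ldistrib matrix_mult_add_distrib_right mixed matrix_mul_assoc[symmetric])
  moreover have "(X ** A + Y ** B) ** (X + Y) = X ** A ** X + Y ** B ** Y"
    by (simp add: matrix_add_ldistrib matrix_mult_add_distrib_right mixed matrix_mul_assoc[symmetric])
  ultimately show ?thesis
    using X Y unfolding is_moore_penrose_def l r by (simp add: conj_transpose_add)
qed

theorem theorem3p2:
  fixes A B :: "complex^'n^'n"
  assumes "A ** conj_transpose B + B ** conj_transpose B = 0"
    and "conj_transpose B ** A + conj_transpose B ** B = 0"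
  shows "moore_penrose (A + B) = moore_penrose A + moore_penrose B"
proof -
  let ?C = "A + B"
  have "?C ** conj_transpose B = 0" "conj_transpose B ** ?C = 0"
    using assms by (simp_all only: matrix_add_ldistrib matrix_mult_add_distrib_right)
  then have "?C ** conj_transpose (- B) = 0" "conj_transpose (- B) ** ?C = 0"
    by (simp_all only: conj_transpose_minus matrix_mult_minus_left matrix_mult_minus_right
        minus_zero)
  then have "is_moore_penrose (?C + - B) (moore_penrose ?C + - moore_penrose B)"
    by (intro is_moore_penrose_add is_moore_penrose_uminus is_moore_penrose_moore_penrose)
  then have "moore_penrose A = moore_penrose ?C - moore_penrose B"
    by (intro moore_penrose_eqI) simp
  then show ?thesis by simp
qed

end
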